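(* Let $\rho\in\mathbb{R}^{3}$ and let $R\in\mathbb{SO}(3)$ be the rotation matrix whose Rodriguez parameters vector is $\rho$, i.e. $R=\frac{1}{1+\Vert\rho\Vert^{2}}\left((1-\Vert\rho\Vert^{2})\mathbf{I}_{3}+2\rho\rho^{\top}+2[\rho]_{\times}\right)$. Then $$\mathbf{vex}\left(\boldsymbol{\mathcal{P}}_{a}(R)\right)=2\frac{\rho}{1+\Vert\rho\Vert^{2}},$$ $$\left\Vert R\right\Vert_{I}=\frac{\Vert\rho\Vert^{2}}{1+\Vert\rho\Vert^{2}},$$ $$\left\Vert \mathbf{vex}\left(\boldsymbol{\mathcal{P}}_{a}(R)\right)\right\Vert^{2}=4\frac{\Vert\rho\Vert^{2}}{\left(1+\Vert\rho\Vert^{2}\right)^{2}}.$$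
   Context: $\mathbb{SO}(3)=\{R\in\mathbb{R}^{3\times3}: R^{\top}R=RR^{\top}=\mathbf{I}_{3},\ \det(R)=+1\}$; $\Vert\cdot\Vert$ is the Euclidean norm on vectors. For $x=[x_1,x_2,x_3]^{\top}\in\mathbb{R}^{3}$, $[x]_{\times}=\begin{bmatrix} 0 & -x_3 & x_2 \\ x_3 & 0 & -x_1 \\ -x_2 & x_1 & 0 \end{bmatrix}$, so $[x]_{\times} y=x\times y$. The map $\mathbf{vex}$ from $3\times3$ skew-symmetric matrices to $\mathbb{R}^{3}$ is the inverse of $[\cdot]_{\times}$, i.e. $\mathbf{vex}([x]_{\times})=x$. For $B\in\mathbb{R}^{3\times3}$, $\boldsymbol{\mathcal{P}}_{a}(B)=\frac{1}{2}(B-B^{\top})$. For $R\in\mathbb{SO}(3)$ the normalized Euclidean distance is $\Vert R\Vert_{I}=\frac{1}{4}\mathrm{Tr}\{\mathbf{I}_{3}-R\}$. *)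

theory Defs
  imports "HOL-Analysis.Analysis"
begin

definition cross_mat :: "real^3 \<Rightarrow> real^3^3" where
  "cross_mat x = vector [vector [0, - x$3, x$2],
                         vector [x$3, 0, - x$1],
                         vector [- x$2, x$1, 0]]"

lemma cross_mat_mult: "cross_mat x *v y = cross3 x y"
  by (simp add: vec_eq_iff forall_3 cross_mat_def cross3_def matrix_vector_mult_def sum_3)

lemma inj_cross_mat: "inj cross_mat"
proof (rule injI)
  fix x y assume "cross_mat x = cross_mat y"
  then have "cross_mat x $ i $ j = cross_mat y $ i $ j" for i j by simp
  from this[of 2 1] this[of 1 3] this[of 3 2] show "x = y"
    by (simp add: vec_eq_iff forall_3 cross_mat_def)
qed

lemma range_cross_mat: "range cross_mat = {A. transpose A = - A}"
proof (intro equalityI subsetI)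
  fix A assume "A \<in> range cross_mat"
  then show "A \<in> {A. transpose A = - A}"
    by (auto simp: vec_eq_iff forall_3 cross_mat_def transpose_def)
next
  fix A :: "real^3^3" assume "A \<in> {A. transpose A = - A}"
  then have "transpose A $ i $ j = (- A) $ i $ j" for i j by simp
  then have e: "A$j$i = - A$i$j" for i j
    unfolding transpose_def vec_lambda_beta vector_uminus_component .
  have "A = cross_mat (vector [A$3$2, A$1$3, A$2$1])"
    unfolding vec_eq_iff forall_3 cross_mat_def vector_3
    using e[of 1 1] e[of 2 2] e[of 3 3] e[of 1 2] e[of 3 1] e[of 2 3]
    by (intro conjI; linarith)
  then show "A \<in> range cross_mat" by blast
qed

text \<open>The inverse of \<^const>\<open>cross_mat\<close>; its value is meaningful only on skew-symmetric
  matrices, which by \<open>range_cross_mat\<close> are exactly the range of \<^const>\<open>cross_mat\<close>.\<close>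

definition vex :: "real^3^3 \<Rightarrow> real^3" where
  "vex = inv cross_mat"

lemma vex_cross_mat [simp]: "vex (cross_mat x) = x"
  by (simp add: vex_def inj_cross_mat)

lemma cross_mat_vex: "transpose A = - A \<Longrightarrow> cross_mat (vex A) = A"
  using range_cross_mat by (simp add: vex_def f_inv_into_f)

definition antisym_proj :: "real^3^3 \<Rightarrow> real^3^3" where
  "antisym_proj B = (1/2) *\<^sub>R (B - transpose B)"

definition norm_I :: "real^3^3 \<Rightarrow> real" where
  "norm_I R = (1/4) * trace (mat 1 - R)"

definition rodriguez_mat :: "real^3 \<Rightarrow> real^3^3" where
  "rodriguez_mat \<rho> =
     (1 / (1 + (norm \<rho>)\<^sup>2)) *\<^sub>R
       ((1 - (norm \<rho>)\<^sup>2) *\<^sub>R mat 1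
        + 2 *\<^sub>R (columnvector \<rho> ** (rowvector \<rho> :: real^3^1))
        + 2 *\<^sub>R cross_mat \<rho>)"

lemma rotation_rodriguez_mat: "rotation_matrix (rodriguez_mat \<rho>)"
proof -
  define a b c where abc: "a = \<rho>$1" "b = \<rho>$2" "c = \<rho>$3"
  define n where "n = (norm \<rho>)\<^sup>2"
  have n: "n = a\<^sup>2 + b\<^sup>2 + c\<^sup>2"
    unfolding n_def abc power2_norm_eq_inner by (simp add: inner_vec_def sum_3 power2_eq_square)
  define k where "k = 1 / (1 + n)"
  have "1 + n \<noteq> 0" unfolding n_def by (smt (verit) zero_le_power2)
  then have k: "k * (1 + (a\<^sup>2 + b\<^sup>2 + c\<^sup>2)) = 1" by (simp add: k_def n)
  define Q where "Q = rodriguez_mat \<rho>"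
  have Q: "Q$1$1 = k * (1 + a\<^sup>2 - b\<^sup>2 - c\<^sup>2)" "Q$1$2 = k * (2*a*b - 2*c)"
    "Q$1$3 = k * (2*a*c + 2*b)" "Q$2$1 = k * (2*a*b + 2*c)"
    "Q$2$2 = k * (1 - a\<^sup>2 + b\<^sup>2 - c\<^sup>2)" "Q$2$3 = k * (2*b*c - 2*a)"
    "Q$3$1 = k * (2*a*c - 2*b)" "Q$3$2 = k * (2*b*c + 2*a)"
    "Q$3$3 = k * (1 - a\<^sup>2 - b\<^sup>2 + c\<^sup>2)"
    unfolding Q_def rodriguez_mat_def n_def[symmetric] k_def[symmetric]
    by (simp_all add: n mat_def columnvector_def rowvector_def
        matrix_matrix_mult_def cross_mat_def abc[symmetric] power2_eq_square algebra_simps)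
  define w where "w = k * (1 + (a\<^sup>2 + b\<^sup>2 + c\<^sup>2))"
  have w: "w = 1" using k by (simp add: w_def)
  have diag: "Q$1$1*Q$1$1 + Q$2$1*Q$2$1 + Q$3$1*Q$3$1 = w\<^sup>2"
    "Q$1$2*Q$1$2 + Q$2$2*Q$2$2 + Q$3$2*Q$3$2 = w\<^sup>2"
    "Q$1$3*Q$1$3 + Q$2$3*Q$2$3 + Q$3$3*Q$3$3 = w\<^sup>2"
    unfolding Q w_def by (simp_all add: algebra_simps power2_eq_square)
  have off: "Q$1$1*Q$1$2 + Q$2$1*Q$2$2 + Q$3$1*Q$3$2 = 0"
    "Q$1$1*Q$1$3 + Q$2$1*Q$2$3 + Q$3$1*Q$3$3 = 0"
    "Q$1$2*Q$1$3 + Q$2$2*Q$2$3 + Q$3$2*Q$3$3 = 0"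
    unfolding Q by (simp_all add: algebra_simps power2_eq_square)
  have "transpose Q ** Q = mat 1"
    unfolding vec_eq_iff forall_3 using diag off
    by (simp add: matrix_matrix_mult_def transpose_def mat_def sum_3 w mult.commute)
  moreover have "det Q = w ^ 3"
    unfolding det_3 Q w_def by (simp add: algebra_simps power2_eq_square power3_eq_cube)
  then have "det Q = 1" by (simp add: w)
  ultimately show ?thesis
    by (simp add: rotation_matrix_def orthogonal_matrix Q_def)
qed

end

theory Submission
  imports Defs
begin

text \<open>Write n for the squared norm of \<rho>. Of the three summands of R, the identity and the
  outer product of \<rho> with itself are symmetric, and the cross matrix is skew. So
  \<open>antisym_proj\<close> keeps only the last one; \<open>antisym_proj_rodriguez_mat\<close>
  exhibits it as a value of \<open>cross_mat\<close>, which \<open>vex\<close> inverts. The trace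
  sees only the symmetric summands and gives the distance. The third formula is the squared norm of
  the first.\<close>

lemma antisym_proj_rodriguez_mat:
  "antisym_proj (rodriguez_mat \<rho>) = cross_mat (2 *\<^sub>R ((1 / (1 + (norm \<rho>)\<^sup>2)) *\<^sub>R \<rho>))"
  by (simp add: vec_eq_iff forall_3 antisym_proj_def rodriguez_mat_def transpose_def mat_def
      columnvector_def rowvector_def matrix_matrix_mult_def cross_mat_def algebra_simps)

lemma trace_rodriguez_mat:
  "trace (rodriguez_mat \<rho>) = (3 - (norm \<rho>)\<^sup>2) / (1 + (norm \<rho>)\<^sup>2)"
proof -
  define n where "n = (norm \<rho>)\<^sup>2"
  have n: "\<rho>$1 * \<rho>$1 + \<rho>$2 * \<rho>$2 + \<rho>$3 * \<rho>$3 = n"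
    unfolding n_def power2_norm_eq_inner by (simp add: inner_vec_def sum_3)
  \<comment> \<open>The outer product contributes the sum of squares, kept explicit here; replacing
    it by \<open>n\<close> turns the numerator into 3(1 - n) + 2n = 3 - n.\<close>
  have "trace (rodriguez_mat \<rho>) =
      (3 * (1 - n) + 2 * (\<rho>$1 * \<rho>$1 + \<rho>$2 * \<rho>$2 + \<rho>$3 * \<rho>$3)) / (1 + n)"
    unfolding rodriguez_mat_def n_def[symmetric]
    by (simp add: trace_def sum_3 mat_def columnvector_def rowvector_def
        matrix_matrix_mult_def cross_mat_def add_divide_distrib diff_divide_distrib algebra_simps)
  then show ?thesis
    unfolding n n_def[symmetric] by simp
qed

text \<open>Since \<open>mat 1\<close> has trace 3, the claim reduces to 3 - (3 - n)/(1 + n) = 4n/(1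
  + n) with n the squared norm; the factor 1/4 cancels the 4.\<close>

lemma norm_I_rodriguez_mat:
  "norm_I (rodriguez_mat \<rho>) = (norm \<rho>)\<^sup>2 / (1 + (norm \<rho>)\<^sup>2)"
proof -
  have "1 + (norm \<rho>)\<^sup>2 \<noteq> 0"
    by (smt (verit) zero_le_power2)
  then show ?thesis
    by (simp add: norm_I_def trace_sub trace_I trace_rodriguez_mat field_simps)
qed

theorem lemma2:
  fixes \<rho> :: "real^3" and R :: "real^3^3"
  assumes "rotation_matrix R"
    and "R = rodriguez_mat \<rho>"
  shows "vex (antisym_proj R) = 2 *\<^sub>R ((1 / (1 + (norm \<rho>)\<^sup>2)) *\<^sub>R \<rho>)
    \<and> norm_I R = (norm \<rho>)\<^sup>2 / (1 + (norm \<rho>)\<^sup>2)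
    \<and> (norm (vex (antisym_proj R)))\<^sup>2 = 4 * ((norm \<rho>)\<^sup>2 / (1 + (norm \<rho>)\<^sup>2)\<^sup>2)"
proof -
  have "vex (antisym_proj R) = 2 *\<^sub>R ((1 / (1 + (norm \<rho>)\<^sup>2)) *\<^sub>R \<rho>)"
    unfolding assms(2) antisym_proj_rodriguez_mat by (rule vex_cross_mat)
  then show ?thesis
    by (simp add: assms(2) norm_I_rodriguez_mat power_mult_distrib power_divide)
qed

end
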